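(* Suppose the rate of consumption $c$ is such that the boundary value problem $$\lambda h(w) = (rw - c(w)) h'(w) + \min_{\pi\in\mathbb{R}} \left[ (\mu - r) \pi h'(w) + \tfrac12 \sigma^2 \pi^2 h''(w) \right] \ (-\infty < w < w^s), \quad h(0)=1, \quad h(w)=0 \text{ for } w \ge w^s,$$ has a solution $h \in C^1(\mathbb{R}) \cap C^2(\mathbb{R} \setminus \{w^s\})$. If, in addition, $c(w) = \bar c + \rho w$ on $(\kappa, w^s)$, in which $0<\kappa<w^s$, $\bar c$ is a constant and $\rho>0$, then the optimal investment strategy $\pi^*$ on $(\kappa,w^s)$ corresponding to $h$ is given by $$\pi^*(w) = \begin{cases} \dfrac{\mu-r}{\sigma^2}\, \dfrac{w + \frac{\bar c}{\rho-r}}{1-d}, & \text{if } \rho\ne r,\\[2ex] \dfrac{\mu-r}{\sigma^2}\,\dfrac{\bar c}{\delta+\lambda}, & \text{if } \rho=r,\end{cases}$$ in which $$d = \frac{1}{2(r-\rho)} \left[ (r-\rho+\lambda+\delta) + \sqrt{(r-\rho+\lambda+\delta)^2 + 4(\rho-r)\lambda} \right].$$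
   Context: Parameters: $r>0$, $\mu>r$, $\sigma>0$, $\lambda>0$, and $\delta=\frac12\left(\frac{\mu-r}{\sigma}\right)^2$. The rate of consumption is a Lipschitz function $c:\mathbb{R}\to[0,\infty)$ of wealth; the safe level is $w^s=\inf\{w\ge0:c(w)=rw\}$, with $\inf\emptyset=\infty$. If $w^s=\infty$, the boundary condition "$h(w)=0$ for $w\ge w^s$" means $\lim_{w\to\infty}h(w)=0$, and $\mathbb{R}\setminus\{w^s\}$ means $\mathbb{R}$. The optimal investment strategy corresponding to $h$ is the minimizer in the differential equation, $\pi^*(w) = -\frac{\mu-r}{\sigma^2}\frac{h'(w)}{h''(w)}$, $w<w^s$; it is the optimal amount to invest in the risky asset in order to minimize the probability of lifetime ruin when wealth follows $dW_t=[rW_t+(\mu-r)\pi_t-c(W_t)]dt+\sigma\pi_t dB_t$ ($B$ a standard Brownian motion) and the time of death is exponential with mean $1/\lambda$, independent of $B$. *)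

theory Defs
  imports "HOL-Analysis.Analysis"
begin

text \<open>
  The hazard rate is written \<open>l\<close>, since the letter lambda is reserved.
  Levels of wealth that may be infinite are of type \<^typ>\<open>ereal\<close>, in which the infimum
  of the empty set is \<open>\<infinity>\<close>.
\<close>

definition safe_level :: "real \<Rightarrow> (real \<Rightarrow> real) \<Rightarrow> ereal" where
  "safe_level r c = Inf (ereal ` {w. 0 \<le> w \<and> c w = r * w})"

definition control_term ::
    "real \<Rightarrow> real \<Rightarrow> real \<Rightarrow> (real \<Rightarrow> real) \<Rightarrow> real \<Rightarrow> real \<Rightarrow> real" where
  "control_term \<mu> r \<sigma> h w p =
     (\<mu> - r) * p * deriv h w + 1/2 * \<sigma>\<^sup>2 * p\<^sup>2 * deriv (deriv h) w"

text \<open>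
  The minimum in the equation is a genuine one: it is required to be attained at some \<open>p\<close>.
  The set of \<open>w\<close> with \<open>ereal w \<noteq> safe_level r c\<close> is open, and all of the real line if the
  safe level is infinite, so the first two clauses say that \<open>h\<close> is \<open>C\<^sup>1\<close> on the
  real line and \<open>C\<^sup>2\<close> off the safe level.
\<close>

definition solves_bvp ::
    "real \<Rightarrow> real \<Rightarrow> real \<Rightarrow> real \<Rightarrow> (real \<Rightarrow> real) \<Rightarrow> (real \<Rightarrow> real) \<Rightarrow> bool" where
  "solves_bvp \<mu> r \<sigma> l c h \<longleftrightarrow>
     h C1_differentiable_on UNIV \<and>
     deriv h C1_differentiable_on {w. ereal w \<noteq> safe_level r c} \<and>
     (\<forall>w. ereal w < safe_level r c \<longrightarrow>
        (\<exists>p. is_arg_min (control_term \<mu> r \<sigma> h w) (\<lambda>_. True) p \<and>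
             l * h w = (r * w - c w) * deriv h w + control_term \<mu> r \<sigma> h w p)) \<and>
     h 0 = 1 \<and>
     (if safe_level r c = \<infinity> then (h \<longlongrightarrow> 0) at_top
      else (\<forall>w. safe_level r c \<le> ereal w \<longrightarrow> h w = 0))"

definition optimal_investment ::
    "real \<Rightarrow> real \<Rightarrow> real \<Rightarrow> (real \<Rightarrow> real) \<Rightarrow> real \<Rightarrow> real" where
  "optimal_investment \<mu> r \<sigma> h w = - ((\<mu> - r) / \<sigma>\<^sup>2) * (deriv h w / deriv (deriv h) w)"

text \<open>
  Where \<open>h''(w) = 0\<close>, the quotient above is \<open>0\<close> by convention. Wherever the optimal
  investment is nonzero, it is therefore a proper quotient, and then it is
  the unique minimizer in the differential equation.
\<close>

lemma control_term_complete_square: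
  assumes "\<sigma> > 0" and "deriv (deriv h) w \<noteq> 0"
  shows "control_term \<mu> r \<sigma> h w p =
    control_term \<mu> r \<sigma> h w (optimal_investment \<mu> r \<sigma> h w)
      + 1/2 * \<sigma>\<^sup>2 * deriv (deriv h) w * (p - optimal_investment \<mu> r \<sigma> h w)\<^sup>2"
proof -
  define q where "q = optimal_investment \<mu> r \<sigma> h w"
  have q: "(\<mu> - r) * deriv h w = - (\<sigma>\<^sup>2 * q * deriv (deriv h) w)"
    using assms by (simp add: q_def optimal_investment_def)
  have *: "control_term \<mu> r \<sigma> h w x =
          - (\<sigma>\<^sup>2 * q * deriv (deriv h) w) * x + 1/2 * \<sigma>\<^sup>2 * x\<^sup>2 * deriv (deriv h) w" for x
    by (simp add: control_term_def flip: q)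
  show ?thesis
    unfolding q_def[symmetric] * by (simp add: power2_eq_square field_simps)
qed

lemma optimal_investment_unique_minimizer:
  assumes sol: "solves_bvp \<mu> r \<sigma> l c h" and "\<sigma> > 0" and "ereal w < safe_level r c"
    and "optimal_investment \<mu> r \<sigma> h w \<noteq> 0"
  shows "is_arg_min (control_term \<mu> r \<sigma> h w) (\<lambda>_. True) p \<longleftrightarrow>
         p = optimal_investment \<mu> r \<sigma> h w"
proof -
  define q where "q = optimal_investment \<mu> r \<sigma> h w"
  define D where "D = 1/2 * \<sigma>\<^sup>2 * deriv (deriv h) w"
  have nz: "deriv (deriv h) w \<noteq> 0"
    using assms(4) by (auto simp: optimal_investment_def)
  then have eq: "control_term \<mu> r \<sigma> h w x = control_term \<mu> r \<sigma> h w q + D * (x - q)\<^sup>2" for x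
    using control_term_complete_square[OF assms(2) nz, of \<mu> r x] by (simp add: q_def D_def)
  obtain p0 where p0: "\<And>x. control_term \<mu> r \<sigma> h w p0 \<le> control_term \<mu> r \<sigma> h w x"
    using sol assms(3) unfolding solves_bvp_def is_arg_min_def by (meson linorder_not_less)
  define t where "t = \<bar>p0 - q\<bar> + 1"
  have "D * (p0 - q)\<^sup>2 \<le> D * t\<^sup>2"
    using p0[of "q + t"] by (simp add: eq[of p0] eq[of "q + t"])
  moreover have "(p0 - q)\<^sup>2 < t\<^sup>2"
    by (simp add: t_def flip: abs_le_square_iff not_le)
  ultimately have "D \<ge> 0"
    by (meson mult_le_cancel_left not_le)
  moreover have "D \<noteq> 0"
    using nz assms(2) by (simp add: D_def)
  ultimately have D: "D > 0" by simp
  have le: "control_term \<mu> r \<sigma> h w q \<le> control_term \<mu> r \<sigma> h w x" for x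
    using D eq[of x] by simp
  have less: "control_term \<mu> r \<sigma> h w q < control_term \<mu> r \<sigma> h w x" if "x \<noteq> q" for x
    using D eq[of x] that by simp
  show ?thesis
    unfolding q_def[symmetric] is_arg_min_def using le less by (meson linorder_not_less)
qed

end

theory Submission imports Defs begin

text \<open>
  Before the safe level \<open>h\<close> is convex, decreasing and positive, and \<open>c w > r w\<close> for \<open>w \<ge> 0\<close>.
  Put \<open>v = - h' / h''\<close> and, where \<open>c\<close> is linear, \<open>A w = c w - r w = cbar + a w\<close> with
  \<open>a = \<rho> - r\<close>. The equation reads \<open>\<delta> v = A + l h / h'\<close>, so that \<open>0 < \<delta> v < A\<close> and, after
  differentiation, \<open>\<delta> v' = l + \<delta> + a - A / v\<close>. For \<open>u = v / A\<close> this is an autonomous equation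
  in the time \<open>\<integral> dw / A\<close>, which is infinite up to the safe level. Its only equilibrium in
  \<open>(0, 1 / \<delta>)\<close> is unstable, and every other solution leaves that interval; hence \<open>u\<close> is constant.
  This treats \<open>\<rho> < r\<close> (finite safe level) and \<open>\<rho> \<ge> r\<close> (infinite safe level) alike.
\<close>

section \<open>Quadratic minimization and two scalar differential equations\<close>

text \<open>Moving from the minimizer \<open>p\<close> to \<open>p + t\<close> changes the value by
  \<open>t * e + 1/2 * s\<^sup>2 * y * t\<^sup>2\<close>, where \<open>e\<close> is the first-order
  residual. Adding the cases \<open>t = 1\<close> and \<open>t = -1\<close> gives
  \<open>0 \<le> y\<close>; then \<open>t = - e / (s\<^sup>2 * y)\<close>, or \<open>t = - e\<close>
  if \<open>y = 0\<close>, forces \<open>e = 0\<close>.\<close>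

lemma arg_min_quadratic:
  fixes b s x y p :: real
  assumes "b \<noteq> 0" "s \<noteq> 0"
    and min: "is_arg_min (\<lambda>p. b * p * x + 1/2 * s\<^sup>2 * p\<^sup>2 * y) (\<lambda>_. True) p"
  shows "y = 0 \<and> x = 0 \<or>
         0 < y \<and> b * p * x + 1/2 * s\<^sup>2 * p\<^sup>2 * y = - (1/2 * (b/s)\<^sup>2) * (x\<^sup>2 / y)"
proof -
  define e where "e = b * x + s\<^sup>2 * p * y"
  have nonneg: "0 \<le> t * e + 1/2 * s\<^sup>2 * y * t\<^sup>2" for t
  proof -
    have "b * p * x + 1/2 * s\<^sup>2 * p\<^sup>2 * y \<le> b * (p + t) * x + 1/2 * s\<^sup>2 * (p + t)\<^sup>2 * y"
      using min unfolding is_arg_min_def by (meson linorder_not_less)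
    then show ?thesis by (simp add: e_def power2_eq_square algebra_simps)
  qed
  have "0 \<le> s\<^sup>2 * y" using nonneg[of 1] nonneg[of "-1"] by simp
  then have y: "0 \<le> y" using assms(2) by (simp add: zero_le_mult_iff)
  have e: "e = 0"
  proof (cases "y = 0")
    case True
    have "0 \<le> - (e * e)" using nonneg[of "-e"] True by simp
    then show ?thesis by (auto simp: mult_le_0_iff)
  next
    case False
    define q where "q = s\<^sup>2 * y"
    have q: "q > 0" using False y assms(2) by (simp add: q_def)
    have "0 \<le> (- e / q) * e + 1/2 * q * (- e / q)\<^sup>2"
      using nonneg[of "- e / q"] by (simp only: q_def mult.assoc)
    also have "\<dots> = - (e\<^sup>2 / (2 * q))"
      using q by (simp add: power2_eq_square field_simps)
    finally have "0 \<le> - (e\<^sup>2 / (2 * q))" .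
    then have "e\<^sup>2 / (2 * q) \<le> 0" by simp
    then show ?thesis using q by (simp add: divide_le_0_iff)
  qed
  show ?thesis
  proof (cases "y = 0")
    case True
    then show ?thesis using e assms(1) by (simp add: e_def)
  next
    case False
    then have p: "p = - (b * x) / (s\<^sup>2 * y)"
      using e assms(2) by (simp add: e_def field_simps)
    have "b * p * x + 1/2 * s\<^sup>2 * p\<^sup>2 * y = 1/2 * p * (b * x) + 1/2 * p * e"
      by (simp add: e_def power2_eq_square algebra_simps)
    also have "\<dots> = - (1/2 * (b/s)\<^sup>2) * (x\<^sup>2 / y)"
      unfolding e p using False assms(2) by (simp add: power2_eq_square field_simps)
    finally have "b * p * x + 1/2 * s\<^sup>2 * p\<^sup>2 * y = - (1/2 * (b/s)\<^sup>2) * (x\<^sup>2 / y)" .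
    then show ?thesis using False y by simp
  qed
qed

text \<open>
  At a first zero \<open>w\<close> of \<open>h\<close> one would have \<open>h' = 0\<close>; but just before \<open>w\<close> the equation
  gives \<open>h'' \<le> K \<bar>h'\<bar>\<close>, so that \<open>h' exp (K x)\<close> is decreasing and \<open>h'\<close> vanishes there as well.
\<close>

lemma convex_solution_pos:
  fixes h h1 h2 A :: "real \<Rightarrow> real" and a b l \<delta> :: real
  assumes "a \<le> b" "0 < l" "0 < \<delta>"
    and h: "\<And>x. a \<le> x \<Longrightarrow> x \<le> b \<Longrightarrow> (h has_real_derivative h1 x) (at x)"
    and h1: "\<And>x. a \<le> x \<Longrightarrow> x \<le> b \<Longrightarrow> (h1 has_real_derivative h2 x) (at x)"
    and contA: "continuous_on {a..b} A"
    and A: "\<And>x. a \<le> x \<Longrightarrow> x \<le> b \<Longrightarrow> 0 < A x"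
    and h1_le: "\<And>x. a \<le> x \<Longrightarrow> x \<le> b \<Longrightarrow> h1 x \<le> 0"
    and h2_ge: "\<And>x. a \<le> x \<Longrightarrow> x \<le> b \<Longrightarrow> 0 \<le> h2 x"
    and zero: "\<And>x. a \<le> x \<Longrightarrow> x \<le> b \<Longrightarrow> h x = 0 \<Longrightarrow> h1 x = 0"
    and ode: "\<And>x. a \<le> x \<Longrightarrow> x \<le> b \<Longrightarrow> h x \<noteq> 0 \<Longrightarrow>
                0 < h2 x \<and> l * h x = - A x * h1 x - \<delta> * ((h1 x)\<^sup>2 / h2 x)"
    and "0 < h a"
  shows "0 < h b"
proof (rule ccontr)
  assume neg: "\<not> 0 < h b"
  have conth: "continuous_on {a..b} h"
    using h by (intro DERIV_continuous_on) (auto intro: has_field_derivative_at_within)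
  have conth1: "continuous_on {a..b} h1"
    using h1 by (intro DERIV_continuous_on) (auto intro: has_field_derivative_at_within)
  define S where "S = {x \<in> {a..b}. h x = 0}"
  have "\<exists>x. a \<le> x \<and> x \<le> b \<and> h x = 0"
    using IVT2'[of h b 0 a] neg assms(1,12) conth by auto
  then have ne: "S \<noteq> {}" by (auto simp: S_def)
  have "closed S"
    unfolding S_def using conth
    by (intro continuous_closed_preimage_constant) auto
  moreover have bdd: "bdd_below S" by (auto simp: S_def)
  ultimately have inf: "Inf S \<in> S" using ne by (intro closed_contains_Inf)
  define w where "w = Inf S"
  have w: "a < w" "w \<le> b" "h w = 0"
    using inf assms(12) by (auto simp: S_def w_def order_less_le)
  have ne0: "h x \<noteq> 0" if "a \<le> x" "x < w" for x
    using that w cInf_lower[OF _ bdd, of x] by (force simp: S_def w_def)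
  have anti: "h y \<le> h x" if "a \<le> x" "x \<le> y" "y \<le> b" for x y
    using that by (intro DERIV_nonpos_imp_nonincreasing[of x y h]) (meson h h1_le order_trans)+
  have mono1: "h1 x \<le> h1 y" if "a \<le> x" "x \<le> y" "y \<le> b" for x y
    using that by (intro DERIV_nonneg_imp_nondecreasing[of x y h1]) (meson h1 h2_ge order_trans)+
  have pos: "0 < h x" if "a \<le> x" "x < w" for x
    using anti[of x w] that w ne0[of x] by auto
  obtain x0 where x0: "x0 \<in> {a..b}" "\<And>x. x \<in> {a..b} \<Longrightarrow> A x0 \<le> A x"
    using continuous_attains_inf[OF _ _ contA] assms(1) by auto
  define m where "m = A x0"
  have m: "0 < m" "\<And>x. a \<le> x \<Longrightarrow> x \<le> b \<Longrightarrow> m \<le> A x"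
    using x0 A by (auto simp: m_def)
  \<comment> \<open>The point \<open>v\<close> is so close to \<open>w\<close> that
    \<open>l * (w - x) \<le> m / 2\<close> for \<open>x\<close> in \<open>[v, w)\<close>. By
    convexity \<open>h x \<le> (w - v) * - h1 x\<close>, so \<open>l * h x\<close> uses up at most
    half of \<open>A x * - h1 x\<close>. The other half bounds
    \<open>\<delta> * (h1 x)\<^sup>2 / h2 x\<close> from below, which is
    \<open>h2 x \<le> K * - h1 x\<close>.\<close>
  define K where "K = 2 * \<delta> / m"
  define v where "v = max a (w - m / (2 * l))"
  have v: "a \<le> v" "v < w" "l * (w - v) \<le> m / 2"
    using w m assms(2) by (auto simp: v_def max_def field_simps)
  have bound: "h2 x \<le> K * - h1 x" if x: "v \<le> x" "x < w" for x
  proof -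
    have ax: "a \<le> x" "x \<le> b" using x v w by auto
    have hx: "0 < h x" using pos ax x by auto
    have o: "0 < h2 x" "l * h x = - A x * h1 x - \<delta> * ((h1 x)\<^sup>2 / h2 x)"
      using ode[OF ax] hx by auto
    have n: "h1 x < 0"
      using o hx assms(2) h1_le[OF ax] by (cases "h1 x = 0") auto
    obtain z where z: "x < z" "z < w" "h w - h x = (w - x) * h1 z"
      using MVT2[of x w h h1] x ax w h by (meson order_trans less_imp_le)
    have "h x = (w - x) * - h1 z" using z w by simp
    also have "\<dots> \<le> (w - v) * - h1 x"
      using mono1[of x z] z ax w x n v h1_le[of z] by (intro mult_mono) auto
    finally have "l * h x \<le> l * ((w - v) * - h1 x)" using assms(2) by (intro mult_left_mono) auto
    also have "\<dots> \<le> m / 2 * - h1 x"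
      using mult_right_mono[OF v(3), of "- h1 x"] n by (simp add: algebra_simps)
    finally have 1: "l * h x \<le> m / 2 * - h1 x" .
    have 2: "m * - h1 x \<le> A x * - h1 x" using m(2)[OF ax] n by (intro mult_right_mono) auto
    have "m / 2 * - h1 x \<le> \<delta> * ((h1 x)\<^sup>2 / h2 x)" using 1 2 o(2) by simp
    then have "m / 2 * - h1 x * h2 x \<le> \<delta> * (h1 x)\<^sup>2"
      using o(1) by (simp add: field_simps)
    then have "(m / 2 * h2 x) * - h1 x \<le> (\<delta> * - h1 x) * - h1 x"
      by (simp add: power2_eq_square algebra_simps)
    then have "m / 2 * h2 x \<le> \<delta> * - h1 x"
      using n by (subst (asm) mult_le_cancel_right) auto
    then show ?thesis using m(1) by (simp add: K_def field_simps)
  qed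
  have nonneg1: "0 \<le> h1 x" if x: "v \<le> x" "x < w" for x
  proof -
    have "h1 w * exp (K * w) \<le> h1 x * exp (K * x)"
    proof (rule DERIV_nonpos_imp_decreasing_open[of x w "\<lambda>t. h1 t * exp (K * t)"])
      fix t assume t: "x < t" "t < w"
      have "((\<lambda>t. h1 t * exp (K * t)) has_real_derivative
             h2 t * exp (K * t) + exp (K * t) * K * h1 t) (at t)"
        using t x v w by (auto intro!: derivative_eq_intros h1)
      moreover have "h2 t * exp (K * t) + exp (K * t) * K * h1 t = (h2 t - K * - h1 t) * exp (K * t)"
        by (simp add: algebra_simps)
      moreover have "(h2 t - K * - h1 t) * exp (K * t) \<le> 0"
        using bound[of t] t x by (intro mult_nonpos_nonneg) auto
      ultimately show "\<exists>y. ((\<lambda>t. h1 t * exp (K * t)) has_real_derivative y) (at t) \<and> y \<le> 0"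
        by auto
    next
      show "continuous_on {x..w} (\<lambda>t. h1 t * exp (K * t))"
        using x v w by (intro continuous_intros continuous_on_subset[OF conth1]) auto
    qed (use x in auto)
    then show ?thesis using zero[of w] w by (simp add: zero_le_mult_iff)
  qed
  obtain z where z: "v < z" "z < w" "h w - h v = (w - v) * h1 z"
    using MVT2[of v w h h1] v w h by (meson order_trans less_imp_le)
  moreover have "0 \<le> (w - v) * h1 z" using nonneg1[of z] z by simp
  ultimately have "h v \<le> h w" by simp
  then show False using pos[of v] v w by simp
qed

text \<open>
  The distance of \<open>v / A\<close> to the equilibrium \<open>1 / z\<close> grows at least exponentially in the time
  \<open>T = \<integral> dw / A\<close>, while \<open>v / A\<close> is confined to a bounded interval.
\<close>

lemma unstable_equilibrium:
  fixes v A T :: "real \<Rightarrow> real" and a l \<delta> z :: real and I :: "real set"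
  assumes I: "is_interval I" and "0 < \<delta>"
    and z: "0 < z" "\<delta> < z" "a < z" "z + \<delta> * a / z = l + \<delta> + a"
    and A: "\<And>x. x \<in> I \<Longrightarrow> (A has_real_derivative a) (at x)" "\<And>x. x \<in> I \<Longrightarrow> 0 < A x"
    and T: "\<And>x. x \<in> I \<Longrightarrow> (T has_real_derivative 1 / A x) (at x)"
    and unbounded: "\<And>x B. x \<in> I \<Longrightarrow> \<exists>y\<in>I. x < y \<and> B < T y"
    and v: "\<And>x. x \<in> I \<Longrightarrow> (v has_real_derivative (l + \<delta> + a - A x / v x) / \<delta>) (at x)"
    and v_bounds: "\<And>x. x \<in> I \<Longrightarrow> 0 < v x" "\<And>x. x \<in> I \<Longrightarrow> \<delta> * v x < A x"
    and w: "w \<in> I"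
  shows "v w = A w / z"
proof (rule ccontr)
  assume "v w \<noteq> A w / z"
  define u where "u = (\<lambda>x. v x / A x)"
  \<comment> \<open>In the time \<open>T\<close>, the deviation \<open>u - 1 / z\<close> grows at
    the rate \<open>Q\<close>. Since \<open>0 < \<delta> * u < 1\<close>, the numerator of
    \<open>Q\<close> is at least \<open>z - max 0 a = k\<close> and its denominator is below 1, so
    \<open>k\<close> bounds the rate from below.\<close>
  define k where "k = min z (z - a)"
  define y where "y = (\<lambda>x. (u x - 1 / z)\<^sup>2)"
  define Q where "Q = (\<lambda>x. (z - \<delta> * a * u x) / (\<delta> * u x))"
  have k: "0 < k" using z by (auto simp: k_def)
  have u: "0 < u x" "\<delta> * u x < 1" if "x \<in> I" for x
    using v_bounds[OF that] A(2)[OF that] by (auto simp: u_def field_simps)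
  have Q: "k \<le> Q x" if "x \<in> I" for x
  proof -
    have "a * (\<delta> * u x) \<le> max 0 a * (\<delta> * u x)"
      using u(1)[OF that] assms(2) by (intro mult_right_mono) auto
    also have "\<dots> \<le> max 0 a * 1"
      using u(2)[OF that] by (intro mult_left_mono) auto
    finally have "\<delta> * a * u x \<le> max 0 a" by (simp add: mult.assoc mult.left_commute)
    then have 1: "k \<le> z - \<delta> * a * u x" by (auto simp: k_def max_def split: if_splits)
    have "k * (\<delta> * u x) \<le> k * 1" using u(2)[OF that] k by (intro mult_left_mono) auto
    then show ?thesis using 1 u(1)[OF that] assms(2) by (simp add: Q_def pos_le_divide_eq)
  qed
  have du: "(u has_real_derivative (u x - 1 / z) * Q x / A x) (at x)" if "x \<in> I" for x
  proof -
    have ne: "A x \<noteq> 0" "v x \<noteq> 0" using A(2)[OF that] v_bounds(1)[OF that] by auto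
    have "(u has_real_derivative
        ((l + \<delta> + a - A x / v x) / \<delta> * A x - v x * a) / (A x * A x)) (at x)"
      unfolding u_def using DERIV_divide[OF v[OF that] A(1)[OF that] ne(1)] .
    \<comment> \<open>Writing \<open>l + \<delta> + a\<close> as \<open>z + \<delta> * a / z\<close>
      exhibits \<open>u = 1 / z\<close> as a root of the right-hand side; \<open>Q\<close> is the
      remaining factor.\<close>
    moreover have "((l + \<delta> + a - A x / v x) / \<delta> * A x - v x * a) / (A x * A x)
                 = (u x - 1 / z) * Q x / A x"
      unfolding z(4)[symmetric] Q_def u_def
      using ne z(1) assms(2) by (simp add: field_simps)
    ultimately show ?thesis by simp
  qed
  \<comment> \<open>The squared deviation \<open>y\<close> grows at rate at least
    \<open>2 * k\<close> in the time \<open>T\<close>, so this quotient by the pure exponential is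
    nondecreasing.\<close>
  define E where "E = (\<lambda>x. y x * exp (- 2 * k * T x))"
  have dE: "\<exists>D. (E has_real_derivative D) (at x) \<and> 0 \<le> D" if "x \<in> I" for x
  proof -
    have "(E has_real_derivative
        2 * (u x - 1 / z) * ((u x - 1 / z) * Q x / A x) * exp (- 2 * k * T x)
        + exp (- 2 * k * T x) * (- 2 * k * (1 / A x)) * y x) (at x)"
      unfolding E_def y_def
      by (auto intro!: derivative_eq_intros du[OF that] T[OF that])
    moreover have "2 * C * (C * q / B) * e + e * (- 2 * k * (1 / B)) * C\<^sup>2
        = 2 * C\<^sup>2 * e * (q - k) / B" for C q B e
      by (simp add: power2_eq_square diff_divide_distrib algebra_simps)
    then have "2 * (u x - 1 / z) * ((u x - 1 / z) * Q x / A x) * exp (- 2 * k * T x)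
        + exp (- 2 * k * T x) * (- 2 * k * (1 / A x)) * y x
        = 2 * y x * exp (- 2 * k * T x) * (Q x - k) / A x"
      unfolding y_def .
    moreover have "0 \<le> 2 * y x * exp (- 2 * k * T x) * (Q x - k) / A x"
      using Q[OF that] A(2)[OF that] by (simp add: y_def)
    ultimately show ?thesis by metis
  qed
  have y0: "0 < y w"
    using \<open>v w \<noteq> A w / z\<close> A(2)[OF w] z(1) by (simp add: y_def u_def field_simps)
  \<comment> \<open>After time \<open>B\<close> the exponential lower bound for \<open>y\<close>
    exceeds \<open>1 / \<delta>\<^sup>2\<close>. This is impossible, because \<open>u\<close> and
    \<open>1 / z\<close> both lie between 0 and \<open>1 / \<delta>\<close>.\<close>
  define B where "B = T w + ln (1 / (\<delta>\<^sup>2 * y w)) / (2 * k)"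
  obtain x where x: "x \<in> I" "w < x" "B < T x" using unbounded[OF w] by blast
  have "t \<in> I" if "w \<le> t" "t \<le> x" for t
    using I w x(1) that unfolding is_interval_1 by blast
  then have "E w \<le> E x"
    using x(2) dE by (intro DERIV_nonneg_imp_nondecreasing[of w x E]) auto
  then have "y w * exp (2 * k * (T x - T w)) \<le> y x"
    by (simp add: E_def exp_diff exp_minus field_simps)
  moreover have "1 / \<delta>\<^sup>2 < y w * exp (2 * k * (T x - T w))"
  proof -
    have "ln (1 / (\<delta>\<^sup>2 * y w)) < 2 * k * (T x - T w)"
      using x(3) k by (simp add: B_def field_simps)
    then have "exp (ln (1 / (\<delta>\<^sup>2 * y w))) < exp (2 * k * (T x - T w))" by simp
    then have "1 / (\<delta>\<^sup>2 * y w) < exp (2 * k * (T x - T w))"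
      using y0 assms(2) by simp
    then show ?thesis using y0 assms(2) by (simp add: field_simps)
  qed
  moreover have "y x \<le> (1 / \<delta>)\<^sup>2"
  proof -
    have "u x < 1 / \<delta>" "1 / z < 1 / \<delta>" "0 < 1 / z"
      using u[OF x(1)] assms(2) z by (auto simp: field_simps)
    then have "\<bar>u x - 1 / z\<bar> \<le> \<bar>1 / \<delta>\<bar>" using u(1)[OF x(1)] by linarith
    then show ?thesis unfolding y_def by (simp only: abs_le_square_iff)
  qed
  ultimately show False by (simp add: power_divide)
qed

text \<open>\<open>z\<close> is the larger root of
  \<open>z\<^sup>2 - (l + \<delta> + a) * z + \<delta> * a\<close>. The given form of the
  discriminant yields \<open>a < z\<close>, and its other form
  \<open>(l - \<delta> + a)\<^sup>2 + 4 * l * \<delta>\<close> yields \<open>\<delta> < z\<close>.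
  The latter puts the equilibrium \<open>1 / z\<close> inside \<open>(0, 1 / \<delta>)\<close>, and
  \<open>0 < z\<close> with \<open>a < z\<close> makes it unstable there.\<close>

lemma characteristic_root:
  fixes a l \<delta> :: real
  assumes "0 < l" "0 < \<delta>"
  defines "z \<equiv> (l + \<delta> + a + sqrt ((l + \<delta> - a)\<^sup>2 + 4 * a * l)) / 2"
  shows "0 < z" "\<delta> < z" "a < z" "z + \<delta> * a / z = l + \<delta> + a"
proof -
  define R where "R = sqrt ((l + \<delta> - a)\<^sup>2 + 4 * a * l)"
  have D: "(l + \<delta> - a)\<^sup>2 + 4 * a * l = (l - \<delta> + a)\<^sup>2 + 4 * (l * \<delta>)"
    by (simp add: power2_eq_square algebra_simps)
  have ld: "0 < l * \<delta>" using assms by simp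
  have "\<bar>l - \<delta> + a\<bar> < R"
    unfolding R_def D using ld by (intro real_less_rsqrt) simp
  then show 1: "\<delta> < z" by (simp add: z_def R_def)
  then show 0: "0 < z" using assms by simp
  show "a < z"
  proof (cases "0 < a")
    case True
    then have "\<bar>l + \<delta> - a\<bar> < R"
      unfolding R_def using assms by (intro real_less_rsqrt) simp
    then show ?thesis by (simp add: z_def R_def)
  qed (use 0 in auto)
  have "R\<^sup>2 = (l + \<delta> - a)\<^sup>2 + 4 * a * l"
    unfolding R_def D using ld by (simp add: add_nonneg_nonneg)
  moreover have "z = (l + \<delta> + a + R) / 2" unfolding z_def R_def ..
  then have "R = 2 * z - (l + \<delta> + a)" by (simp add: field_simps)
  ultimately have "z * z + \<delta> * a = (l + \<delta> + a) * z"
    by (simp add: power2_eq_square algebra_simps)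
  then show "z + \<delta> * a / z = l + \<delta> + a" using 0 by (simp add: field_simps)
qed

section \<open>Sign and convexity of the solution below the safe level\<close>

lemma bvp_has_derivative:
  assumes "solves_bvp \<mu> r \<sigma> l c h"
  shows "(h has_real_derivative deriv h w) (at w)"
    and "continuous_on UNIV (deriv h)"
    and "ereal w \<noteq> safe_level r c \<Longrightarrow> (deriv h has_real_derivative deriv (deriv h) w) (at w)"
proof -
  obtain D where D: "\<And>x. (h has_real_derivative D x) (at x)" "continuous_on UNIV D"
    using assms unfolding solves_bvp_def C1_differentiable_on_def
    by (auto simp: has_real_derivative_iff_has_vector_derivative)
  then have "deriv h = D" by (auto intro: DERIV_imp_deriv)
  with D show "(h has_real_derivative deriv h w) (at w)" "continuous_on UNIV (deriv h)" by auto
  show "(deriv h has_real_derivative deriv (deriv h) w) (at w)" if w: "ereal w \<noteq> safe_level r c"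
  proof -
    obtain D2 where "(deriv h has_real_derivative D2 w) (at w)"
      using assms w unfolding solves_bvp_def C1_differentiable_on_def
      by (auto simp: has_real_derivative_iff_has_vector_derivative)
    then show ?thesis using DERIV_imp_deriv by metis
  qed
qed

text \<open>If \<open>h''\<close> vanishes, a minimum exists only if \<open>h'\<close> vanishes too,
  and the equation then reduces to \<open>l * h w = 0\<close>. This degenerate alternative is
  excluded for nonnegative wealth only in \<open>bvp_pos\<close>.\<close>

lemma bvp_cases:
  assumes "solves_bvp \<mu> r \<sigma> l c h" "r < \<mu>" "0 < \<sigma>" "0 < l" "ereal w < safe_level r c"
  shows "deriv (deriv h) w = 0 \<and> deriv h w = 0 \<and> h w = 0 \<or>
         0 < deriv (deriv h) w \<and>
         l * h w = (r * w - c w) * deriv h w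
           - (1/2 * ((\<mu> - r) / \<sigma>)\<^sup>2) * ((deriv h w)\<^sup>2 / deriv (deriv h) w)"
proof -
  obtain p where p: "is_arg_min (control_term \<mu> r \<sigma> h w) (\<lambda>_. True) p"
    "l * h w = (r * w - c w) * deriv h w + control_term \<mu> r \<sigma> h w p"
    using assms unfolding solves_bvp_def by blast
  have "is_arg_min (\<lambda>p. (\<mu> - r) * p * deriv h w + 1/2 * \<sigma>\<^sup>2 * p\<^sup>2 * deriv (deriv h) w) (\<lambda>_. True) p"
    using p(1) by (simp add: control_term_def[abs_def])
  from arg_min_quadratic[OF _ _ this] assms(2,3)
  show ?thesis using p(2) assms(4) unfolding control_term_def by auto
qed

text \<open>By convexity \<open>h'\<close> is nondecreasing, so it suffices to look at the right
  end. At a finite safe level \<open>h'\<close> is 0; if the safe level is infinite, a positive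
  slope would keep \<open>h\<close> above an increasing line, against its limit 0.\<close>

lemma bvp_deriv_nonpos:
  assumes sol: "solves_bvp \<mu> r \<sigma> l c h" and "r < \<mu>" "0 < \<sigma>" "0 < l"
    and w: "ereal w < safe_level r c"
  shows "deriv h w \<le> 0"
proof -
  have convex: "0 \<le> deriv (deriv h) x" if "ereal x < safe_level r c" for x
    using bvp_cases[OF sol assms(2-4) that] by auto
  note deriv = bvp_has_derivative[OF sol]
  show ?thesis
  proof (cases "safe_level r c")
    case (real s)
    \<comment> \<open>\<open>h\<close> is 0 on \<open>{s..}\<close>, so its right derivative at
      \<open>s\<close> is 0. As \<open>h\<close> is differentiable at \<open>s\<close> itself, this
      is the full derivative.\<close>
    have "(h has_real_derivative 0) (at s within {s..})"
    proof (rule has_field_derivative_transform_within[of "\<lambda>_. 0" 0 s "{s..}" 1])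
      show "0 = h x" if "x \<in> {s..}" for x
        using sol that real by (auto simp: solves_bvp_def)
    qed auto
    moreover have "(h has_real_derivative deriv h s) (at s within {s..})"
      using deriv(1) by (rule has_field_derivative_at_within)
    moreover have "at s within {s..} \<noteq> bot"
      by (simp add: at_within_Ici_at_right)
    ultimately have s: "deriv h s = 0"
      unfolding has_field_derivative_iff by (blast intro: tendsto_unique)
    have "deriv h w \<le> deriv h s"
    proof (rule DERIV_nonneg_imp_increasing_open[of w s "deriv h"])
      show "\<exists>y. (deriv h has_real_derivative y) (at x) \<and> 0 \<le> y" if "w < x" "x < s" for x
        using deriv(3)[of x] convex[of x] that real by force
      show "continuous_on {w..s} (deriv h)" using deriv(2) continuous_on_subset by blast
    qed (use w real in auto)
    then show ?thesis using s by simp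
  next
    case PInf
    show ?thesis
    proof (rule ccontr)
      assume neg: "\<not> deriv h w \<le> 0"
      have tangent: "h w + deriv h w * (x - w) \<le> h x" if x: "w < x" for x
      proof -
        obtain t where t: "w < t" "t < x" "h x - h w = (x - w) * deriv h t"
          using MVT2[OF x, of h "deriv h"] deriv(1) by metis
        have "deriv h w \<le> deriv h t"
          using t deriv(3) convex PInf by (intro DERIV_nonneg_imp_nondecreasing[of w t "deriv h"]) force+
        then have "(x - w) * deriv h w \<le> (x - w) * deriv h t"
          using x by (intro mult_left_mono) auto
        then show ?thesis using t(3) by (simp add: algebra_simps)
      qed
      have "(h \<longlongrightarrow> 0) at_top" using sol PInf by (simp add: solves_bvp_def)
      then have "eventually (\<lambda>x. h x < 1) at_top" by (rule order_tendstoD) simp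
      then obtain N where N: "\<And>x. N \<le> x \<Longrightarrow> h x < 1" by (auto simp: eventually_at_top_linorder)
      \<comment> \<open>At \<open>w + (1 - h w) / deriv h w\<close> the tangent line at
        \<open>w\<close> reaches the value 1, whereas \<open>h\<close> is below 1 from
        \<open>N\<close> on.\<close>
      define x where "x = max N (max (w + 1) (w + (1 - h w) / deriv h w))"
      have "(1 - h w) / deriv h w \<le> x - w" by (simp add: x_def)
      then have "1 \<le> h w + deriv h w * (x - w)" using neg by (simp add: field_simps)
      also have "\<dots> \<le> h x" by (intro tangent) (simp add: x_def)
      finally show False using N[of x] by (simp add: x_def)
    qed
  next
    case MInf
    then show ?thesis using w by simp
  qed
qed

lemma bvp_nonneg:
  assumes sol: "solves_bvp \<mu> r \<sigma> l c h" and "r < \<mu>" "0 < \<sigma>" "0 < l"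
    and w: "ereal w < safe_level r c"
  shows "0 \<le> h w"
proof -
  note deriv = bvp_has_derivative[OF sol]
  have anti: "h y \<le> h x" if "x \<le> y" "ereal y \<le> safe_level r c" for x y
  proof (rule DERIV_nonpos_imp_decreasing_open[of x y h])
    show "\<exists>d. (h has_real_derivative d) (at t) \<and> d \<le> 0" if "x < t" "t < y" for t
      using deriv(1) bvp_deriv_nonpos[OF assms(1-4), of t] that \<open>ereal y \<le> safe_level r c\<close>
      by (meson ereal_less_le less_ereal.simps(1) order_less_le_trans)
    show "continuous_on {x..y} h"
      using deriv(1) by (intro DERIV_continuous_on) (auto intro: has_field_derivative_at_within)
  qed fact
  show ?thesis
  proof (cases "safe_level r c")
    case (real s)
    have "h s \<le> h w" using anti[of w s] w real by simp
    then show ?thesis using sol real by (simp add: solves_bvp_def)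
  next
    case PInf
    then have "(h \<longlongrightarrow> 0) at_top" using sol by (simp add: solves_bvp_def)
    moreover have "eventually (\<lambda>x. h x \<le> h w) at_top"
      using eventually_ge_at_top[of w] by eventually_elim (simp add: anti PInf)
    ultimately show ?thesis by (rule tendsto_upperbound) simp
  next
    case MInf
    then show ?thesis using w by simp
  qed
qed

text \<open>\<open>c x - r * x\<close> is nonnegative at 0, so if it were not positive at
  \<open>w\<close>, it would have a root in \<open>[0, w]\<close>. The safe level is the infimum of
  such roots and lies beyond \<open>w\<close>.\<close>

lemma consumption_exceeds_interest:
  assumes cont: "continuous_on UNIV c" and nonneg: "0 \<le> c 0"
    and w: "0 \<le> w" "ereal w < safe_level r c"
  shows "r * w < c w"
proof (rule ccontr)
  assume "\<not> r * w < c w"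
  moreover have "continuous_on {0..w} (\<lambda>x. c x - r * x)"
    by (intro continuous_intros continuous_on_subset[OF cont]) auto
  ultimately obtain x where x: "0 \<le> x" "x \<le> w" "c x - r * x = 0"
    using IVT2'[of "\<lambda>x. c x - r * x" w 0 0] w nonneg by auto
  then have "safe_level r c \<le> ereal x"
    unfolding safe_level_def by (intro Inf_lower) auto
  also have "\<dots> \<le> ereal w" using x by simp
  finally show False using w by simp
qed

lemma safe_level_root:
  assumes cont: "continuous_on UNIV c" and s: "safe_level r c = ereal s"
  shows "c s = r * s"
proof -
  define S where "S = {w. 0 \<le> w \<and> c w = r * w}"
  have ne: "S \<noteq> {}"
    using s unfolding safe_level_def S_def[symmetric] by (auto simp: top_ereal_def)
  have "closed S"
    unfolding S_def by (intro closed_Collect_conj closed_Collect_le closed_Collect_eq continuous_intros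
        continuous_on_subset[OF cont]) auto
  moreover have bdd: "bdd_below S" by (auto simp: S_def)
  ultimately have inf: "Inf S \<in> S" using ne by (intro closed_contains_Inf)
  have "Inf (ereal ` S) = ereal (Inf S)"
  proof (rule antisym)
    show "Inf (ereal ` S) \<le> ereal (Inf S)" using inf by (intro Inf_lower) auto
    show "ereal (Inf S) \<le> Inf (ereal ` S)"
      using bdd by (intro Inf_greatest) (auto intro: cInf_lower)
  qed
  then have "s = Inf S" using s by (simp add: safe_level_def S_def)
  then show ?thesis using inf by (simp add: S_def)
qed

lemma bvp_pos:
  assumes sol: "solves_bvp \<mu> r \<sigma> l c h" and "r < \<mu>" "0 < \<sigma>" "0 < l"
    and cont: "continuous_on UNIV c" and nonneg: "0 \<le> c 0"
    and w: "0 \<le> w" "ereal w < safe_level r c"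
  shows "0 < h w" "deriv h w < 0" "0 < deriv (deriv h) w"
proof -
  note deriv = bvp_has_derivative[OF sol]
  have below: "ereal x < safe_level r c" if "x \<le> w" for x
    using that w(2) by (meson ereal_less_eq(3) order_le_less_trans)
  note c = bvp_cases[OF assms(1-4)]
  show pos: "0 < h w"
  proof (rule convex_solution_pos[of 0 w l "1/2 * ((\<mu> - r) / \<sigma>)\<^sup>2" h "deriv h"
        "deriv (deriv h)" "\<lambda>x. c x - r * x"])
    fix x assume x: "0 \<le> x" "x \<le> w"
    note bx = below[OF x(2)]
    show "(deriv h has_real_derivative deriv (deriv h) x) (at x)"
      using deriv(3)[of x] bx by auto
    show "0 < c x - r * x"
      using consumption_exceeds_interest[OF cont nonneg x(1) bx] by simp
    show "deriv h x \<le> 0" using bvp_deriv_nonpos[OF assms(1-4) bx] .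
    show "0 \<le> deriv (deriv h) x" using c[OF bx] by auto
    show "deriv h x = 0" if zero: "h x = 0"
    proof -
      \<comment> \<open>Within distance \<open>e\<close> of \<open>x\<close> wealth stays below the
        safe level, where \<open>h\<close> is nonnegative. A zero of \<open>h\<close> is thus a
        local minimum.\<close>
      obtain e where e: "0 < e" "ereal (x + e) < safe_level r c"
        by (metis bx ereal_dense2 diff_gt_0_iff_gt add_diff_cancel_left' diff_add_cancel
            add.commute less_ereal.simps(1))
      have "0 \<le> h y" if "\<bar>x - y\<bar> < e" for y
      proof (rule bvp_nonneg[OF assms(1-4)])
        have "ereal y \<le> ereal (x + e)" using that by simp
        then show "ereal y < safe_level r c" using e(2) by (rule order_le_less_trans)
      qed
      then show ?thesis
        using e(1) zero by (intro DERIV_local_min[OF deriv(1), of e]) auto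
    qed
    show "0 < deriv (deriv h) x \<and> l * h x = - (c x - r * x) * deriv h x
        - 1/2 * ((\<mu> - r) / \<sigma>)\<^sup>2 * ((deriv h x)\<^sup>2 / deriv (deriv h) x)" if "h x \<noteq> 0"
      using c[OF bx] that by auto
  next
    show "continuous_on {0..w} (\<lambda>x. c x - r * x)"
      by (intro continuous_intros continuous_on_subset[OF cont]) auto
    show "0 < h 0" using sol by (simp add: solves_bvp_def)
  qed (use assms deriv(1) in auto)
  \<comment> \<open>Positivity of \<open>h\<close> rules out the degenerate alternative of
    \<open>bvp_cases\<close>; in the other one, \<open>h' = 0\<close> would again give
    \<open>l * h w = 0\<close>.\<close>
  then show "0 < deriv (deriv h) w" "deriv h w < 0"
    using c[OF w(2)] bvp_deriv_nonpos[OF assms(1-4) w(2)] assms(4)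
    by (auto simp: order_less_le)
qed

section \<open>The Riccati equation and its divergent time\<close>

text \<open>Defining \<open>v\<close> through \<open>h / h'\<close> instead of
  \<open>h' / h''\<close> makes it differentiable although \<open>h\<close> is only twice
  differentiable. With \<open>A\<close> for the affine term,
  \<open>l * h / h' = \<delta> * v - A\<close> and \<open>h'' / h' = - 1 / v\<close>, so the
  derivative of \<open>l * h / h'\<close> is \<open>l + (\<delta> * v - A) / v\<close>.\<close>

lemma bvp_riccati:
  assumes sol: "solves_bvp \<mu> r \<sigma> l c h" and "r < \<mu>" "0 < \<sigma>" "0 < l"
    and cont: "continuous_on UNIV c" and nonneg: "0 \<le> c 0"
    and "0 \<le> \<kappa>"
    and linear: "\<forall>x. \<kappa> < x \<and> ereal x < safe_level r c \<longrightarrow> c x = cbar + \<rho> * x"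
    and \<delta>: "\<delta> = 1/2 * ((\<mu> - r) / \<sigma>)\<^sup>2"
    and w: "\<kappa> < w" "ereal w < safe_level r c"
  defines "v \<equiv> \<lambda>x. (l * h x / deriv h x + (cbar + (\<rho> - r) * x)) / \<delta>"
  shows "v w = - (deriv h w / deriv (deriv h) w)"
    and "0 < v w"
    and "\<delta> * v w < cbar + (\<rho> - r) * w"
    and "(v has_real_derivative
           (l + \<delta> + (\<rho> - r) - (cbar + (\<rho> - r) * w) / v w) / \<delta>) (at w)"
proof -
  have "0 \<le> w" using assms(7) w by simp
  note pos = bvp_pos[OF assms(1-6) this w(2)]
  note deriv = bvp_has_derivative[OF sol]
  have \<delta>_pos: "0 < \<delta>" using assms(2,3) by (simp add: \<delta>)
  define H where "H = h w"
  define p where "p = deriv h w"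
  define q where "q = deriv (deriv h) w"
  note H = pos[folded H_def p_def q_def]
  have "l * H = (r * w - c w) * p - \<delta> * (p\<^sup>2 / q)"
    using bvp_cases[OF assms(1-4) w(2), folded \<delta>] pos by (auto simp: H_def p_def q_def)
  then have eq: "l * H = - (cbar + (\<rho> - r) * w) * p - \<delta> * (p\<^sup>2 / q)"
    using linear w by (simp add: algebra_simps)
  have "l * H / p + (cbar + (\<rho> - r) * w) = - (\<delta> * (p / q))"
    unfolding eq using H by (simp add: power2_eq_square field_simps)
  then have vpq: "v w = - (p / q)"
    using \<delta>_pos by (simp add: v_def H_def[symmetric] p_def[symmetric])
  then show "v w = - (deriv h w / deriv (deriv h) w)" by (simp add: p_def q_def)
  show "0 < v w" unfolding vpq using H by (simp add: divide_less_0_iff)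
  have "l * H / p < 0" using H assms(4) by (simp add: divide_less_0_iff)
  then show "\<delta> * v w < cbar + (\<rho> - r) * w"
    using \<delta>_pos by (simp add: v_def H_def p_def)
  have "(v has_real_derivative
      ((l * p * p - l * H * q) / (p * p) + (\<rho> - r)) / \<delta>) (at w)"
    unfolding v_def using H \<delta>_pos w(2)
    by (auto intro!: derivative_eq_intros deriv simp: H_def p_def q_def)
  moreover have "(l * p * p - l * H * q) / (p * p) = l + \<delta> - (cbar + (\<rho> - r) * w) / v w"
    unfolding vpq eq using H by (simp add: power2_eq_square field_simps)
  ultimately show "(v has_real_derivative
      (l + \<delta> + (\<rho> - r) - (cbar + (\<rho> - r) * w) / v w) / \<delta>) (at w)"
    by (simp only: diff_add_eq)
qed

text \<open>The integral of \<open>1 / (b + a * x)\<close> diverges at the right end: the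
  denominator grows at most linearly if \<open>s\<close> is infinite and has a simple zero at
  \<open>s\<close> otherwise. This supplies the unbounded time that
  \<open>unstable_equilibrium\<close> requires.\<close>

lemma clock_exists:
  fixes a b \<kappa> :: real and s :: ereal
  assumes "ereal \<kappa> < s"
    and pos: "\<And>x. \<kappa> < x \<Longrightarrow> ereal x < s \<Longrightarrow> 0 < b + a * x"
    and end_zero: "\<And>t. s = ereal t \<Longrightarrow> b + a * t = 0"
  obtains T where
    "\<And>x. \<kappa> < x \<Longrightarrow> ereal x < s \<Longrightarrow> (T has_real_derivative 1 / (b + a * x)) (at x)"
    "\<And>x B. \<kappa> < x \<Longrightarrow> ereal x < s \<Longrightarrow> \<exists>y. x < y \<and> ereal y < s \<and> B < T y"
proof (cases "s = \<infinity>")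
  case True
  have "0 \<le> a"
  proof (rule ccontr)
    assume neg: "\<not> 0 \<le> a"
    \<comment> \<open>With a negative slope, the affine function would be nonpositive from its root
      \<open>- b / a\<close> on.\<close>
    define x where "x = max (\<kappa> + 1) (- b / a)"
    have "\<kappa> < x" "- b / a \<le> x" by (auto simp: x_def)
    moreover from this(2) neg have "a * x \<le> a * (- b / a)" by (intro mult_left_mono_neg) auto
    ultimately show False using pos[of x] neg True by simp
  qed
  then consider "a = 0" | "0 < a" by linarith
  then show ?thesis
  proof cases
    case 1
    have b: "0 < b" using pos[of "\<kappa> + 1"] True 1 by simp
    show ?thesis
    proof (rule that[of "\<lambda>x. x / b"])
      show "\<exists>y. x < y \<and> ereal y < s \<and> B < y / b" for x B
        using b True by (intro exI[of _ "max (x + 1) (B * b + 1)"]) (simp add: field_simps max_def)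
    qed (use 1 b in \<open>auto intro!: derivative_eq_intros\<close>)
  next
    case 2
    show ?thesis
    proof (rule that[of "\<lambda>x. ln (b + a * x) / a"])
      fix x B assume "\<kappa> < x" "ereal x < s"
      show "((\<lambda>x. ln (b + a * x) / a) has_real_derivative 1 / (b + a * x)) (at x)"
        using pos[of x] \<open>\<kappa> < x\<close> \<open>ereal x < s\<close> 2
        by (auto intro!: derivative_eq_intros)
      define y where "y = max (x + 1) ((exp (B * a) + 1 - b) / a)"
      have "x < y" by (simp add: y_def)
      have "(exp (B * a) + 1 - b) / a \<le> y" by (simp add: y_def)
      then have "exp (B * a) < b + a * y" using 2 by (simp add: field_simps)
      then have "ln (exp (B * a)) < ln (b + a * y)"
        by (subst ln_less_cancel_iff) (auto intro: less_trans[OF exp_gt_zero])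
      then show "\<exists>y. x < y \<and> ereal y < s \<and> B < ln (b + a * y) / a"
        using 2 True \<open>x < y\<close> by (auto simp: pos_less_divide_eq)
    qed
  qed
next
  case False
  with assms(1) obtain t where t: "s = ereal t" by (cases s) auto
  have bt: "b = - a * t" using end_zero[OF t] by simp
  have "0 < b + a * ((\<kappa> + t) / 2)" using assms(1) t by (intro pos) auto
  then have "0 < a * ((\<kappa> - t) / 2)" by (simp add: bt field_simps)
  moreover have "\<kappa> < t" using assms(1) t by simp
  ultimately have a: "a < 0" by (simp add: zero_less_mult_iff)
  show ?thesis
  proof (rule that[of "\<lambda>x. ln (b + a * x) / a"])
    fix x B assume x: "\<kappa> < x" "ereal x < s"
    show "((\<lambda>x. ln (b + a * x) / a) has_real_derivative 1 / (b + a * x)) (at x)"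
      using pos[of x] x a by (auto intro!: derivative_eq_intros)
    \<comment> \<open>The first bound keeps \<open>t - e\<close> to the right of \<open>x\<close>.
      As \<open>b + a * (t - e) = - a * e\<close>, the second makes this value less than
      \<open>exp (B * a)\<close>; dividing the logarithms by the negative \<open>a\<close> reverses
      the inequality.\<close>
    define e where "e = min ((t - x) / 2) (exp (B * a) / (- a) / 2)"
    have "x < t" "0 < exp (B * a) / (- a) / 2" using x t a by (simp_all add: divide_pos_neg)
    then have e: "0 < e" "x < t - e" by (auto simp: e_def min_def field_simps)
    have "e < exp (B * a) / (- a)" using \<open>0 < exp (B * a) / (- a) / 2\<close> by (simp add: e_def)
    then have "b + a * (t - e) < exp (B * a)"
      using a by (simp add: bt field_simps)
    moreover have "0 < b + a * (t - e)" using e x t by (intro pos) auto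
    ultimately have "ln (b + a * (t - e)) < ln (exp (B * a))"
      by (subst ln_less_cancel_iff) auto
    then have "B < ln (b + a * (t - e)) / a" using a by (simp add: field_simps)
    then show "\<exists>y. x < y \<and> ereal y < s \<and> B < ln (b + a * y) / a"
      using e t by (intro exI[of _ "t - e"]) auto
  qed
qed

section \<open>The equilibrium and the closed formula\<close>

theorem theorem4p2:
  fixes r \<mu> \<sigma> l \<delta> \<kappa> \<rho> cbar d :: real
    and c h :: "real \<Rightarrow> real"
  assumes "r > 0" and "\<mu> > r" and "\<sigma> > 0" and "l > 0"
    and "\<delta> = 1/2 * ((\<mu> - r) / \<sigma>)\<^sup>2"
    and "\<forall>w. 0 \<le> c w" and "\<exists>L. L-lipschitz_on UNIV c"
    and "solves_bvp \<mu> r \<sigma> l c h"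
    and "0 < \<kappa>" and "ereal \<kappa> < safe_level r c"
    and "\<rho> > 0"
    and "\<forall>w. \<kappa> < w \<and> ereal w < safe_level r c \<longrightarrow> c w = cbar + \<rho> * w"
    and "d = 1 / (2 * (r - \<rho>)) *
          ((r - \<rho> + l + \<delta>) + sqrt ((r - \<rho> + l + \<delta>)\<^sup>2 + 4 * (\<rho> - r) * l))"
  shows "\<forall>w. \<kappa> < w \<and> ereal w < safe_level r c \<longrightarrow>
    optimal_investment \<mu> r \<sigma> h w =
      (if \<rho> \<noteq> r then (\<mu> - r) / \<sigma>\<^sup>2 * ((w + cbar / (\<rho> - r)) / (1 - d))
       else (\<mu> - r) / \<sigma>\<^sup>2 * (cbar / (\<delta> + l)))"
proof (intro allI impI)
  fix w assume w: "\<kappa> < w \<and> ereal w < safe_level r c"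
  note sol = assms(8)
  have cont: "continuous_on UNIV c"
    using assms(7) by (auto intro: lipschitz_on_continuous_on)
  have \<delta>: "0 < \<delta>" using assms(2,3) by (simp add: assms(5))
  define a where "a = \<rho> - r"
  define A where "A x = cbar + a * x" for x
  define I where "I = {x. \<kappa> < x \<and> ereal x < safe_level r c}"
  have A_pos: "0 < A x" if "\<kappa> < x" "ereal x < safe_level r c" for x
    using consumption_exceeds_interest[OF cont, of x r] assms(6,9,12) that
    by (auto simp: A_def a_def algebra_simps)
  \<comment> \<open>The linear form of \<open>c\<close> is given only on the open interval;
    continuity carries it to \<open>s\<close>, where \<open>c s = r * s\<close>.\<close>
  have A_end: "A s = 0" if s: "safe_level r c = ereal s" for s
  proof -
    have "\<kappa> < s" using assms(10) s by simp
    have "(c \<longlongrightarrow> c s) (at_left s)"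
      using cont by (metis UNIV_I continuous_on_def open_UNIV at_within_open filterlim_at_split)
    moreover have "((\<lambda>x. cbar + \<rho> * x) \<longlongrightarrow> cbar + \<rho> * s) (at_left s)"
      by (intro tendsto_intros)
    moreover have "eventually (\<lambda>x. cbar + \<rho> * x = c x) (at_left s)"
      using eventually_at_left_real[OF \<open>\<kappa> < s\<close>]
      by eventually_elim (use assms(12) s in auto)
    ultimately have "c s = cbar + \<rho> * s"
      by (intro tendsto_unique[OF trivial_limit_at_left_real, of c]) (auto intro: Lim_transform_eventually)
    then show ?thesis using safe_level_root[OF cont s] by (simp add: A_def a_def algebra_simps)
  qed
  obtain T where T:
    "\<And>x. \<kappa> < x \<Longrightarrow> ereal x < safe_level r c \<Longrightarrow> (T has_real_derivative 1 / A x) (at x)"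
    "\<And>x B. \<kappa> < x \<Longrightarrow> ereal x < safe_level r c \<Longrightarrow>
       \<exists>y. x < y \<and> ereal y < safe_level r c \<and> B < T y"
    using clock_exists[OF assms(10), of cbar a, folded A_def] A_pos A_end by metis
  define v where "v x = (l * h x / deriv h x + A x) / \<delta>" for x
  note v = bvp_riccati[OF sol assms(2,3,4) cont assms(6)[rule_format] less_imp_le[OF assms(9)]
      assms(12,5), folded a_def, folded A_def, folded v_def]
  define R where "R = sqrt ((l + \<delta> - a)\<^sup>2 + 4 * a * l)"
  define z where "z = (l + \<delta> + a + R) / 2"
  note z = characteristic_root[OF assms(4) \<delta>, of a, folded R_def, folded z_def]
  have "v w = A w / z"
  proof (rule unstable_equilibrium[of I \<delta> z a l A T v])
    show "is_interval I"
      unfolding is_interval_1 I_def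
      by (auto intro: order_le_less_trans[of "ereal _" "ereal _"])
    fix x assume "x \<in> I"
    then have x: "\<kappa> < x" "ereal x < safe_level r c" by (simp_all add: I_def)
    show "0 < A x" using A_pos[OF x] .
    show "(A has_real_derivative a) (at x)"
      unfolding A_def[abs_def] by (auto intro!: derivative_eq_intros)
    show "(T has_real_derivative 1 / A x) (at x)" using T(1)[OF x] .
    show "\<exists>y\<in>I. x < y \<and> B < T y" for B
      using T(2)[OF x, of B] x(1) by (auto simp: I_def intro: less_trans)
    show "(v has_real_derivative (l + \<delta> + a - A x / v x) / \<delta>) (at x)" using v(4)[OF x] .
    show "0 < v x" using v(2)[OF x] .
    show "\<delta> * v x < A x" using v(3)[OF x] .
  qed (use w in \<open>auto simp: I_def intro: \<delta> z\<close>)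
  then have opt: "optimal_investment \<mu> r \<sigma> h w = (\<mu> - r) / \<sigma>\<^sup>2 * (A w / z)"
    using v(1)[of w] w by (metis minus_mult_commute optimal_investment_def)
  show "optimal_investment \<mu> r \<sigma> h w =
      (if \<rho> \<noteq> r then (\<mu> - r) / \<sigma>\<^sup>2 * ((w + cbar / (\<rho> - r)) / (1 - d))
       else (\<mu> - r) / \<sigma>\<^sup>2 * (cbar / (\<delta> + l)))"
  proof (cases "\<rho> = r")
    case True
    then have "z = \<delta> + l" using assms(4) \<delta> by (simp add: z_def R_def a_def)
    then show ?thesis using True by (simp add: opt A_def a_def)
  next
    case False
    then have a: "a \<noteq> 0" by (simp add: a_def)
    \<comment> \<open>Hence \<open>1 - d = (l + \<delta> + a + R) / (2 * a) = z / a\<close>, and the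
      factor \<open>a\<close> cancels in \<open>A w / z\<close>.\<close>
    have "d = - (l + \<delta> - a + R) / (2 * a)"
      unfolding assms(13) R_def a_def using False by (simp add: field_simps)
    then have "z = a * (1 - d)" using a by (simp add: z_def field_simps)
    moreover have "A w = a * (w + cbar / a)" using a by (simp add: A_def field_simps)
    ultimately have "A w / z = (w + cbar / a) / (1 - d)" using a by simp
    then show ?thesis using False by (simp add: opt a_def)
  qed
qed

end
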